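(* Let $L=\mathrm{Log}(\mathcal F)$ be a tabular quasi-normal modal logic, $\mathcal F$ a finite set of finite frames each rooted at $0$. Let $\varphi$ be a modal formula and $\sigma\subseteq\mathrm{sig}(\varphi)$. For each $\mathfrak F\in\mathcal F$ let $\xi_{\mathfrak F}\in\mathrm{PL}(\sigma_{\mathfrak F})$ be a propositional uniform $\sigma_{\mathfrak F}$-interpolant for $\mathit{tr}_{\mathfrak F,0}(\varphi)$. Then $\bigvee_{\mathfrak F\in\mathcal F}\mathit{rt}_{\mathfrak F,L}(\xi_{\mathfrak F})$ is a strongest $L(\sigma)$-implicate of $\varphi$.
   Context: For $\mathfrak F=(W,R)$: $\sigma'_{\mathfrak F}=\{p_w:p\in\sigma',w\in W\}$; $\mathit{tr}_{\mathfrak F,w}$: $p\mapsto p_w$, commutes with $\top,\neg,\wedge$, $\Diamond\varphi\mapsto\bigvee_{(w,w')\in R}\mathit{tr}_{\mathfrak F,w'}(\varphi)$ ($\Box=\neg\Diamond\neg$). Let $N=\max_{\mathfrak G\in\mathcal F}|\mathfrak G|$, $\Box^{\le N}\psi=\psi\wedge\Box\psi\wedge\dots\wedge\Box^N\psi$, $\Diamond^{\le N}=\neg\Box^{\le N}\neg$. $\sigma$-EME: finite pairwise inconsistent set $\Phi$ of propositional formulas over $\sigma$ with tautological disjunction; $\sigma$-cover of a model: worlds satisfying the same member agree on $\sigma$. $\mathit{cover}(\sigma,\Phi)=\bigwedge_{\phi\in\Phi}\bigwedge_{p\in\sigma}(\Diamond^{\le N}(\phi\wedge p)\to\Box^{\le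 N}(\phi\to p))$. Abstract $\Phi$-model for $L$: $(\mathfrak G,f)$, $\mathfrak G\in\mathcal F$, $f$ from worlds to $\Phi$; formulas over $\Phi$ treat its members as atoms ($w\models\phi$ iff $f(w)=\phi$); abstract $\Phi$-bisimulations satisfy Forth, Back and equal $f$-values on related worlds. An abstract class identifier is a formula $\delta$ over $\Phi$ such that the abstract $\Phi$-models for $L$ satisfying $\delta$ at the root form exactly one class of abstract-$\Phi$-bisimilarity at roots, denoted $[\delta]_L$. A $\sigma$-encoding for $L$: $(\Gamma,\{\Delta_\Phi\}_{\Phi\in\Gamma})$, $\Gamma$ a set of $\sigma$-EMEs, $\Delta_\Phi$ sets of abstract class identifiers, such that each model on a frame in $\mathcal F$ has a $\sigma$-cover $\Phi\in\Gamma$ and some $\delta\in\Delta_\Phi$ true at its root. With a fixed $\sigma$-encoding, $\mathit{rt}_{\mathfrak F,L}(\xi)=\bigwedge_{\Phi\in\Gamma}\bigwedge_{\delta\in\Delta_\Phi}((\mathit{cover}(\sigma,\Phi)\wedge\delta)\to\bigvee_{(\mathfrak F,f)\in[\delta]_L}\xi^f)$ (disjunction over members of $[\delta]_L$ based on $\mathfrak F$), $\xi^f$ obtained by replacing $p_w$ by $\Diamond^{\le N}(f(w)\wedge p)$. Propositional uniform $S$-interpolant of $\xi'$: propositional $\chi$ over $S$, $\xi'\to\chi$ tautology, $\chi\to\psi$ tautology whenever $\mathrm{sig}(\psi)\cap\mathrm{sig}(\xi')\subseteq S$ and $\xi'\to\psi$ tautology. Strongest $L(\sigma)$-implicate of $\varphi$: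 modal $\chi$, $\mathrm{sig}(\chi)\subseteq\sigma$, $\varphi\to\chi\in L$, $\chi\to\psi\in L$ whenever $\mathrm{sig}(\psi)\subseteq\sigma$ and $\varphi\to\psi\in L$. $\mathrm{Log}(\mathcal F)$: formulas true at the root of every model on every frame of $\mathcal F$. *)

theory Defs
  imports "HOL-Library.FuncSet"
begin

datatype (psig: 'p) pl = PTop | PVar 'p | PNeg "'p pl" | PConj "'p pl" "'p pl"

datatype (sig: 'p) fm = Top | Var 'p | Neg "'p fm" | Conj "'p fm" "'p fm" | Dia "'p fm"

abbreviation POr :: "'p pl \<Rightarrow> 'p pl \<Rightarrow> 'p pl" where
  "POr a b \<equiv> PNeg (PConj (PNeg a) (PNeg b))"
abbreviation PImp :: "'p pl \<Rightarrow> 'p pl \<Rightarrow> 'p pl" where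
  "PImp a b \<equiv> PNeg (PConj a (PNeg b))"

abbreviation Or :: "'p fm \<Rightarrow> 'p fm \<Rightarrow> 'p fm" where
  "Or a b \<equiv> Neg (Conj (Neg a) (Neg b))"
abbreviation Imp :: "'p fm \<Rightarrow> 'p fm \<Rightarrow> 'p fm" where
  "Imp a b \<equiv> Neg (Conj a (Neg b))"
abbreviation Box :: "'p fm \<Rightarrow> 'p fm" where
  "Box a \<equiv> Neg (Dia (Neg a))"

text \<open>Conjunctions and disjunctions indexed by a finite set are formed along an arbitrary but fixed
  enumeration of the index set; they are only meaningful for finite index sets. The empty
  conjunction is truth, the empty disjunction is falsity.\<close>

definition enum_of :: "'i set \<Rightarrow> 'i list" where
  "enum_of A = (SOME xs. set xs = A \<and> distinct xs)"

definition big_por :: "'i set \<Rightarrow> ('i \<Rightarrow> 'p pl) \<Rightarrow> 'p pl" where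
  "big_por A g = foldr POr (map g (enum_of A)) (PNeg PTop)"

definition big_or :: "'i set \<Rightarrow> ('i \<Rightarrow> 'p fm) \<Rightarrow> 'p fm" where
  "big_or A g = foldr Or (map g (enum_of A)) (Neg Top)"

definition big_and :: "'i set \<Rightarrow> ('i \<Rightarrow> 'p fm) \<Rightarrow> 'p fm" where
  "big_and A g = foldr Conj (map g (enum_of A)) Top"

primrec psubst :: "('a \<Rightarrow> 'p fm) \<Rightarrow> 'a pl \<Rightarrow> 'p fm" where
  "psubst s PTop = Top"
| "psubst s (PVar a) = s a"
| "psubst s (PNeg x) = Neg (psubst s x)"
| "psubst s (PConj x y) = Conj (psubst s x) (psubst s y)"

abbreviation emb :: "'p pl \<Rightarrow> 'p fm" where
  "emb \<equiv> psubst Var"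

primrec msubst :: "('a \<Rightarrow> 'p fm) \<Rightarrow> 'a fm \<Rightarrow> 'p fm" where
  "msubst s Top = Top"
| "msubst s (Var a) = s a"
| "msubst s (Neg x) = Neg (msubst s x)"
| "msubst s (Conj x y) = Conj (msubst s x) (msubst s y)"
| "msubst s (Dia x) = Dia (msubst s x)"

text \<open>A formula over a set \<open>\<Phi>\<close> of propositional formulas, whose members act as atoms, has type
  \<open>'p pl fm\<close>; \<open>flat\<close> reads it as an ordinary modal formula.\<close>

abbreviation flat :: "'p pl fm \<Rightarrow> 'p fm" where
  "flat \<equiv> msubst emb"

primrec pval :: "('p \<Rightarrow> bool) \<Rightarrow> 'p pl \<Rightarrow> bool" where
  "pval v PTop \<longleftrightarrow> True"
| "pval v (PVar p) \<longleftrightarrow> v p"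
| "pval v (PNeg x) \<longleftrightarrow> \<not> pval v x"
| "pval v (PConj x y) \<longleftrightarrow> pval v x \<and> pval v y"

definition tautology :: "'p pl \<Rightarrow> bool" where
  "tautology x \<longleftrightarrow> (\<forall>v. pval v x)"

definition uniform_interpolant :: "'p set \<Rightarrow> 'p pl \<Rightarrow> 'p pl \<Rightarrow> bool" where
  "uniform_interpolant S x \<chi> \<longleftrightarrow>
     psig \<chi> \<subseteq> S \<and> tautology (PImp x \<chi>) \<and>
     (\<forall>\<psi>. psig \<psi> \<inter> psig x \<subseteq> S \<and> tautology (PImp x \<psi>) \<longrightarrow> tautology (PImp \<chi> \<psi>))"

datatype 'w frame = Frame (worlds: "'w set") (rel: "('w \<times> 'w) set")

definition finite_rooted_frame :: "'w::zero frame \<Rightarrow> bool" where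
  "finite_rooted_frame F \<longleftrightarrow>
     finite (worlds F) \<and> 0 \<in> worlds F \<and> rel F \<subseteq> worlds F \<times> worlds F \<and>
     (\<forall>w \<in> worlds F. (0, w) \<in> (rel F)\<^sup>*)"

primrec truth :: "'w frame \<Rightarrow> ('p \<Rightarrow> 'w set) \<Rightarrow> 'w \<Rightarrow> 'p fm \<Rightarrow> bool" where
  "truth F V w Top \<longleftrightarrow> True"
| "truth F V w (Var p) \<longleftrightarrow> w \<in> V p"
| "truth F V w (Neg x) \<longleftrightarrow> \<not> truth F V w x"
| "truth F V w (Conj x y) \<longleftrightarrow> truth F V w x \<and> truth F V w y"
| "truth F V w (Dia x) \<longleftrightarrow> (\<exists>w'. (w, w') \<in> rel F \<and> truth F V w' x)"

definition Log :: "'w::zero frame set \<Rightarrow> 'p fm set" where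
  "Log \<F> = {x. \<forall>F \<in> \<F>. \<forall>V. truth F V 0 x}"

definition strongest_implicate :: "'p fm set \<Rightarrow> 'p set \<Rightarrow> 'p fm \<Rightarrow> 'p fm \<Rightarrow> bool" where
  "strongest_implicate L \<sigma> \<phi> \<chi> \<longleftrightarrow>
     sig \<chi> \<subseteq> \<sigma> \<and> Imp \<phi> \<chi> \<in> L \<and>
     (\<forall>\<psi>. sig \<psi> \<subseteq> \<sigma> \<and> Imp \<phi> \<psi> \<in> L \<longrightarrow> Imp \<chi> \<psi> \<in> L)"

text \<open>The indexed variable \<open>p\<^sub>w\<close> is the pair \<open>(p, w)\<close>, so that \<open>\<sigma>\<^sub>F\<close> is \<open>\<sigma> \<times> worlds F\<close>.\<close>

primrec tr :: "'w frame \<Rightarrow> 'w \<Rightarrow> 'p fm \<Rightarrow> ('p \<times> 'w) pl" where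
  "tr F w Top = PTop"
| "tr F w (Var p) = PVar (p, w)"
| "tr F w (Neg x) = PNeg (tr F w x)"
| "tr F w (Conj x y) = PConj (tr F w x) (tr F w y)"
| "tr F w (Dia x) = big_por {w'. (w, w') \<in> rel F} (\<lambda>w'. tr F w' x)"

definition max_size :: "'w frame set \<Rightarrow> nat" where
  "max_size \<F> = Max ((\<lambda>F. card (worlds F)) ` \<F>)"

primrec box_le :: "nat \<Rightarrow> 'p fm \<Rightarrow> 'p fm" where
  "box_le 0 x = x"
| "box_le (Suc n) x = Conj (box_le n x) ((Box ^^ Suc n) x)"

abbreviation dia_le :: "nat \<Rightarrow> 'p fm \<Rightarrow> 'p fm" where
  "dia_le n x \<equiv> Neg (box_le n (Neg x))"

definition eme :: "'p set \<Rightarrow> 'p pl set \<Rightarrow> bool" where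
  "eme \<sigma> \<Phi> \<longleftrightarrow>
     finite \<Phi> \<and> (\<forall>x \<in> \<Phi>. psig x \<subseteq> \<sigma>) \<and>
     (\<forall>x \<in> \<Phi>. \<forall>y \<in> \<Phi>. x \<noteq> y \<longrightarrow> tautology (PNeg (PConj x y))) \<and>
     tautology (big_por \<Phi> (\<lambda>x. x))"

definition is_cover :: "'p set \<Rightarrow> 'p pl set \<Rightarrow> 'w frame \<Rightarrow> ('p \<Rightarrow> 'w set) \<Rightarrow> bool" where
  "is_cover \<sigma> \<Phi> F V \<longleftrightarrow>
     (\<forall>x \<in> \<Phi>. \<forall>u \<in> worlds F. \<forall>w \<in> worlds F.
        truth F V u (emb x) \<and> truth F V w (emb x) \<longrightarrow> (\<forall>p \<in> \<sigma>. u \<in> V p \<longleftrightarrow> w \<in> V p))"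

definition cover :: "'w frame set \<Rightarrow> 'p set \<Rightarrow> 'p pl set \<Rightarrow> 'p fm" where
  "cover \<F> \<sigma> \<Phi> =
     big_and \<Phi> (\<lambda>x. big_and \<sigma> (\<lambda>p.
       Imp (dia_le (max_size \<F>) (Conj (emb x) (Var p)))
           (box_le (max_size \<F>) (Imp (emb x) (Var p)))))"

text \<open>The labelling of an abstract model is only relevant on the worlds of its frame; using
  \<open>\<rightarrow>\<^sub>E\<close> makes sure that different pairs are different abstract models.\<close>

definition abs_models :: "'w frame set \<Rightarrow> 'p pl set \<Rightarrow> ('w frame \<times> ('w \<Rightarrow> 'p pl)) set" where
  "abs_models \<F> \<Phi> = {(G, f). G \<in> \<F> \<and> f \<in> worlds G \<rightarrow>\<^sub>E \<Phi>}"

definition abs_truth :: "'w frame \<Rightarrow> ('w \<Rightarrow> 'p pl) \<Rightarrow> 'w \<Rightarrow> 'p pl fm \<Rightarrow> bool" where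
  "abs_truth G f w \<delta> \<longleftrightarrow> truth G (\<lambda>x. {u. f u = x}) w \<delta>"

definition abs_bisimulation ::
    "'w frame \<Rightarrow> ('w \<Rightarrow> 'p pl) \<Rightarrow> 'w frame \<Rightarrow> ('w \<Rightarrow> 'p pl) \<Rightarrow> ('w \<times> 'w) set \<Rightarrow> bool" where
  "abs_bisimulation G f H g Z \<longleftrightarrow>
     Z \<subseteq> worlds G \<times> worlds H \<and>
     (\<forall>(u, v) \<in> Z. f u = g v \<and>
        (\<forall>u'. (u, u') \<in> rel G \<longrightarrow> (\<exists>v'. (v, v') \<in> rel H \<and> (u', v') \<in> Z)) \<and>
        (\<forall>v'. (v, v') \<in> rel H \<longrightarrow> (\<exists>u'. (u, u') \<in> rel G \<and> (u', v') \<in> Z)))"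

definition abs_bisimilar ::
    "'w::zero frame set \<Rightarrow> 'p pl set \<Rightarrow> (('w frame \<times> ('w \<Rightarrow> 'p pl)) \<times> ('w frame \<times> ('w \<Rightarrow> 'p pl))) set"
  where
  "abs_bisimilar \<F> \<Phi> =
     {((G, f), (H, g)). (G, f) \<in> abs_models \<F> \<Phi> \<and> (H, g) \<in> abs_models \<F> \<Phi> \<and>
        (\<exists>Z. abs_bisimulation G f H g Z \<and> (0, 0) \<in> Z)}"

definition abs_class ::
    "'w::zero frame set \<Rightarrow> 'p pl set \<Rightarrow> 'p pl fm \<Rightarrow> ('w frame \<times> ('w \<Rightarrow> 'p pl)) set" where
  "abs_class \<F> \<Phi> \<delta> = {(G, f) \<in> abs_models \<F> \<Phi>. abs_truth G f 0 \<delta>}"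

definition abs_class_identifier :: "'w::zero frame set \<Rightarrow> 'p pl set \<Rightarrow> 'p pl fm \<Rightarrow> bool" where
  "abs_class_identifier \<F> \<Phi> \<delta> \<longleftrightarrow>
     sig \<delta> \<subseteq> \<Phi> \<and> abs_class \<F> \<Phi> \<delta> \<in> abs_models \<F> \<Phi> // abs_bisimilar \<F> \<Phi>"

text \<open>Finiteness of \<open>\<Gamma>\<close> and of the \<open>\<Delta> \<Phi>\<close> is what makes the conjunction in \<open>rt\<close> a formula.\<close>

definition encoding ::
    "'w::zero frame set \<Rightarrow> 'p set \<Rightarrow> 'p pl set set \<Rightarrow> ('p pl set \<Rightarrow> 'p pl fm set) \<Rightarrow> bool" where
  "encoding \<F> \<sigma> \<Gamma> \<Delta> \<longleftrightarrow>
     finite \<Gamma> \<and> (\<forall>\<Phi> \<in> \<Gamma>. finite (\<Delta> \<Phi>)) \<and>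
     (\<forall>\<Phi> \<in> \<Gamma>. eme \<sigma> \<Phi>) \<and>
     (\<forall>\<Phi> \<in> \<Gamma>. \<forall>\<delta> \<in> \<Delta> \<Phi>. abs_class_identifier \<F> \<Phi> \<delta>) \<and>
     (\<forall>F \<in> \<F>. \<forall>V. \<exists>\<Phi> \<in> \<Gamma>. is_cover \<sigma> \<Phi> F V \<and> (\<exists>\<delta> \<in> \<Delta> \<Phi>. truth F V 0 (flat \<delta>)))"

definition unfold_at :: "'w frame set \<Rightarrow> ('p \<times> 'w) pl \<Rightarrow> ('w \<Rightarrow> 'p pl) \<Rightarrow> 'p fm" where
  "unfold_at \<F> \<xi> f =
     psubst (\<lambda>(p, w). dia_le (max_size \<F>) (Conj (emb (f w)) (Var p))) \<xi>"

definition rt ::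
    "'w::zero frame set \<Rightarrow> 'p set \<Rightarrow> 'p pl set set \<Rightarrow> ('p pl set \<Rightarrow> 'p pl fm set) \<Rightarrow>
     'w frame \<Rightarrow> ('p \<times> 'w) pl \<Rightarrow> 'p fm" where
  "rt \<F> \<sigma> \<Gamma> \<Delta> F \<xi> =
     big_and \<Gamma> (\<lambda>\<Phi>. big_and (\<Delta> \<Phi>) (\<lambda>\<delta>.
       Imp (Conj (cover \<F> \<sigma> \<Phi>) (flat \<delta>))
           (big_or {f. (F, f) \<in> abs_class \<F> \<Phi> \<delta>} (\<lambda>f. unfold_at \<F> \<xi> f))))"

end

(* On a model covered by Phi, labelling each world with the member of Phi true there loses no
   information about sigma, and the reachable worlds are exactly the scope of box_le. Hence
   unfold_at evaluates xi at the labelled model's own sigma-valuation. If phi holds at the root of a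
   model on F, the label of that model is the required disjunct. Conversely, if the disjunct for f
   holds in a model on G, then delta makes (F, f) bisimilar to the labelling of that model; pulling
   the sigma-valuation back along the labels gives a model on F satisfying xi, hence psi, and psi
   transfers to G along the bisimulation. *)
theory Submission
  imports Defs
begin

section \<open>Truth and signatures under finite connectives, substitution and bisimulation\<close>

lemma set_enum_of [simp]: "finite A \<Longrightarrow> set (enum_of A) = A"
  unfolding enum_of_def by (rule someI2_ex) (auto simp: finite_distinct_list)

lemma pval_big_por: "finite A \<Longrightarrow> pval v (big_por A g) \<longleftrightarrow> (\<exists>i\<in>A. pval v (g i))"
proof -
  have "pval v (foldr POr (map g xs) (PNeg PTop)) \<longleftrightarrow> (\<exists>i\<in>set xs. pval v (g i))" for xs
    by (induction xs) auto
  then show "finite A \<Longrightarrow> ?thesis" by (simp add: big_por_def)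
qed

lemma truth_big_or: "finite A \<Longrightarrow> truth F V w (big_or A g) \<longleftrightarrow> (\<exists>i\<in>A. truth F V w (g i))"
proof -
  have "truth F V w (foldr Or (map g xs) (Neg Top)) \<longleftrightarrow> (\<exists>i\<in>set xs. truth F V w (g i))" for xs
    by (induction xs) auto
  then show "finite A \<Longrightarrow> ?thesis" by (simp add: big_or_def)
qed

lemma truth_big_and: "finite A \<Longrightarrow> truth F V w (big_and A g) \<longleftrightarrow> (\<forall>i\<in>A. truth F V w (g i))"
proof -
  have "truth F V w (foldr Conj (map g xs) Top) \<longleftrightarrow> (\<forall>i\<in>set xs. truth F V w (g i))" for xs
    by (induction xs) auto
  then show "finite A \<Longrightarrow> ?thesis" by (simp add: big_and_def)
qed

lemma psig_big_por: "finite A \<Longrightarrow> psig (big_por A g) = (\<Union>i\<in>A. psig (g i))"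
proof -
  have "psig (foldr POr (map g xs) (PNeg PTop)) = (\<Union>i\<in>set xs. psig (g i))" for xs
    by (induction xs) auto
  then show "finite A \<Longrightarrow> ?thesis" by (simp add: big_por_def)
qed

lemma sig_big_or: "finite A \<Longrightarrow> sig (big_or A g) = (\<Union>i\<in>A. sig (g i))"
proof -
  have "sig (foldr Or (map g xs) (Neg Top)) = (\<Union>i\<in>set xs. sig (g i))" for xs
    by (induction xs) auto
  then show "finite A \<Longrightarrow> ?thesis" by (simp add: big_or_def)
qed

lemma sig_big_and: "finite A \<Longrightarrow> sig (big_and A g) = (\<Union>i\<in>A. sig (g i))"
proof -
  have "sig (foldr Conj (map g xs) Top) = (\<Union>i\<in>set xs. sig (g i))" for xs
    by (induction xs) auto
  then show "finite A \<Longrightarrow> ?thesis" by (simp add: big_and_def)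
qed

lemma finite_sig: "finite (sig x)"
  by (induction x) auto

lemma sig_psubst: "sig (psubst s x) = (\<Union>a\<in>psig x. sig (s a))"
  by (induction x) auto

lemma sig_msubst: "sig (msubst s x) = (\<Union>a\<in>sig x. sig (s a))"
  by (induction x) auto

lemma sig_box_le: "sig (box_le n x) = sig x"
proof -
  have "sig ((Box ^^ k) x) = sig x" for k by (induction k) auto
  then show ?thesis by (induction n) (auto simp del: funpow.simps)
qed

lemma pval_cong: "(\<And>a. a \<in> psig x \<Longrightarrow> v a \<longleftrightarrow> v' a) \<Longrightarrow> pval v x \<longleftrightarrow> pval v' x"
  by (induction x) auto

lemma truth_psubst: "truth F V w (psubst s x) \<longleftrightarrow> pval (\<lambda>a. truth F V w (s a)) x"
  by (induction x) auto

text \<open>Moves the substitution into the valuation, so that a \<open>flat\<close> formula can be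
  compared with the same formula read over the atoms \<open>\<Phi>\<close>.\<close>

lemma truth_msubst:
  "truth F V w (msubst s x) \<longleftrightarrow> truth F (\<lambda>a. {u. truth F V u (s a)}) w x"
  by (induction x arbitrary: w) auto

text \<open>Agreement on atoms is asked only for the letters of \<open>x\<close>. This allows one
  invariance result both for the identity under two valuations of one frame and for a bisimulation
  between frames that respects only the letters in \<open>\<sigma>\<close>.\<close>

lemma truth_bisimulation:
  assumes "(u, v) \<in> Z"
    and "\<And>u v u'. (u, v) \<in> Z \<Longrightarrow> (u, u') \<in> rel G \<Longrightarrow> \<exists>v'. (v, v') \<in> rel H \<and> (u', v') \<in> Z"
    and "\<And>u v v'. (u, v) \<in> Z \<Longrightarrow> (v, v') \<in> rel H \<Longrightarrow> \<exists>u'. (u, u') \<in> rel G \<and> (u', v') \<in> Z"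
    and "\<And>u v p. (u, v) \<in> Z \<Longrightarrow> p \<in> sig x \<Longrightarrow> u \<in> V p \<longleftrightarrow> v \<in> V' p"
  shows "truth G V u x \<longleftrightarrow> truth H V' v x"
  using assms(1,4)
proof (induction x arbitrary: u v)
  case (Dia x)
  then have IH: "truth G V u' x \<longleftrightarrow> truth H V' v' x" if "(u', v') \<in> Z" for u' v'
    using that by auto
  show ?case using assms(2,3) Dia.prems(1) IH by fastforce
qed auto

section \<open>Bounded modalities at the root of a finite frame\<close>

lemma truth_box_le:
  "truth F V w (box_le n x) \<longleftrightarrow> (\<forall>k\<le>n. \<forall>u. (w, u) \<in> rel F ^^ k \<longrightarrow> truth F V u x)"
proof -
  have "truth F V w ((Box ^^ k) x) \<longleftrightarrow> (\<forall>u. (w, u) \<in> rel F ^^ k \<longrightarrow> truth F V u x)" for k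
  proof (induction k arbitrary: w)
    case (Suc k)
    \<comment> \<open>The recursion for powers of a relation appends the last step, whereas the
      outermost \<open>Box\<close> takes the first one.\<close>
    have "rel F ^^ Suc k = rel F O rel F ^^ k" by (simp add: relpow_commute)
    with Suc show ?case by (auto simp del: relpow.simps)
  qed simp
  then show ?thesis
    by (induction n) (auto simp: le_Suc_eq simp del: funpow.simps relpow.simps(2))
qed

text \<open>Along a shortest path the distance from \<open>r\<close> takes every value from 0 to the
  distance of \<open>w\<close>. These values are attained at distinct elements of \<open>W\<close>,
  so there are at most \<open>card W\<close> of them.\<close>

lemma reachable_within_card:
  assumes "finite W" "R \<subseteq> W \<times> W" "r \<in> W" "(r, w) \<in> R\<^sup>*"
  shows "\<exists>n<card W. (r, w) \<in> R ^^ n"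
proof -
  \<comment> \<open>The distance from \<open>r\<close>. Its value at unreachable points is arbitrary
    but harmless, because only an inclusion into the image of \<open>W\<close> is claimed.\<close>
  define d where "d u = (LEAST n. (r, u) \<in> R ^^ n)" for u
  have d: "(r, u) \<in> R ^^ d u" if "(r, u) \<in> R ^^ n" for u n
    unfolding d_def using that by (rule LeastI)
  have d_le: "d u \<le> n" if "(r, u) \<in> R ^^ n" for u n
    unfolding d_def using that by (rule Least_le)
  have levels: "{..d u} \<subseteq> d ` W" if "(r, u) \<in> R ^^ n" "d u = k" for u n k
    using that
  proof (induction k arbitrary: u n)
    case 0
    then have "u = r" using d[of u n] by simp
    with 0 assms(3) show ?case by force
  next
    case (Suc k)
    obtain t where t: "(r, t) \<in> R ^^ k" "(t, u) \<in> R"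
      using d[OF Suc.prems(1)] Suc.prems(2) by auto
    \<comment> \<open>If \<open>t\<close> were closer than \<open>k\<close>, one further edge would
      reach \<open>u\<close> in fewer than \<open>Suc k\<close> steps.\<close>
    have "(r, u) \<in> R ^^ Suc (d t)" using d[OF t(1)] t(2) by auto
    then have "d t = k" using d_le d_le[OF t(1)] Suc.prems(2) by fastforce
    then have "{..k} \<subseteq> d ` W" using Suc.IH[OF t(1)] by simp
    moreover have "u \<in> W" using t(2) assms(2) by auto
    ultimately show ?case
      using Suc.prems(2) image_eqI[of "Suc k" d u W] by (simp add: atMost_Suc)
  qed
  obtain n where n: "(r, w) \<in> R ^^ n" using assms(4) rtrancl_imp_relpow by blast
  \<comment> \<open>The initial segment has \<open>d w + 1\<close> elements, which yields the strict
    bound.\<close>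
  have "card {..d w} \<le> card (d ` W)"
    using levels[OF n refl] assms(1) by (intro card_mono) auto
  also have "\<dots> \<le> card W" using assms(1) by (rule card_image_le)
  finally show ?thesis using d[OF n] by (intro exI[of _ "d w"]) simp
qed

lemma relpow_range: "R \<subseteq> W \<times> W \<Longrightarrow> r \<in> W \<Longrightarrow> (r, u) \<in> R ^^ n \<Longrightarrow> u \<in> W"
  by (cases n) auto

text \<open>Every world is reachable from the root within \<open>max_size \<F>\<close> steps, and no
  path leaves the frame. At the root the bounded box is therefore a universal modality, and dually
  the bounded diamond an existential one.\<close>

lemma truth_box_le_root:
  assumes "finite \<F>" "F \<in> \<F>" "finite_rooted_frame F"
  shows "truth F V 0 (box_le (max_size \<F>) x) \<longleftrightarrow> (\<forall>u\<in>worlds F. truth F V u x)"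
proof -
  have F: "finite (worlds F)" "rel F \<subseteq> worlds F \<times> worlds F" "0 \<in> worlds F"
    "\<And>w. w \<in> worlds F \<Longrightarrow> (0, w) \<in> (rel F)\<^sup>*"
    using assms(3) by (auto simp: finite_rooted_frame_def)
  have "card (worlds F) \<le> max_size \<F>"
    unfolding max_size_def using assms(1,2) by (intro Max_ge) auto
  then have "\<exists>n\<le>max_size \<F>. (0, w) \<in> rel F ^^ n" if "w \<in> worlds F" for w
    using reachable_within_card[OF F(1-3) F(4)[OF that]]
    by (meson less_imp_le order.trans)
  then show ?thesis
    unfolding truth_box_le using relpow_range[OF F(2,3)] by blast
qed

lemma truth_cover:
  assumes "finite \<F>" "F \<in> \<F>" "finite_rooted_frame F" "finite \<Phi>" "finite \<sigma>"
  shows "truth F V 0 (cover \<F> \<sigma> \<Phi>) \<longleftrightarrow> is_cover \<sigma> \<Phi> F V"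
  unfolding cover_def is_cover_def
  by (simp add: truth_big_and truth_box_le_root assms) blast

text \<open>Evaluation takes place in \<open>G\<close>, although \<open>f\<close> may label the
  worlds of another frame: the variable \<open>(p, w)\<close> asks whether some world of
  \<open>G\<close> satisfying the label \<open>f w\<close> lies in \<open>V p\<close>.\<close>

lemma truth_unfold_at:
  assumes "finite \<F>" "G \<in> \<F>" "finite_rooted_frame G"
  shows "truth G V 0 (unfold_at \<F> \<xi> f) \<longleftrightarrow>
    pval (\<lambda>(p, w). \<exists>u\<in>worlds G. truth G V u (emb (f w)) \<and> u \<in> V p) \<xi>"
  \<comment> \<open>Instantiating with \<open>\<xi>\<close> opens the outer substitution only;
    \<open>emb\<close> is a substitution too and has to stay folded.\<close>
  unfolding unfold_at_def truth_psubst[of _ _ _ _ \<xi>]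
  by (intro pval_cong) (auto simp: truth_box_le_root assms)

section \<open>Translation into propositional logic\<close>

text \<open>A propositional valuation of the pairs \<open>(p, w)\<close> is the same data as a modal
  valuation, so validity on \<open>F\<close> at \<open>w\<close> becomes being a tautology.\<close>

lemma pval_tr:
  assumes "finite (worlds F)" "rel F \<subseteq> worlds F \<times> worlds F"
  shows "pval v (tr F w x) \<longleftrightarrow> truth F (\<lambda>p. {u. v (p, u)}) w x"
proof -
  have "finite {w'. (u, w') \<in> rel F}" for u
    using assms by (auto intro: finite_subset[of _ "worlds F"])
  then show ?thesis by (induction x arbitrary: w) (auto simp: pval_big_por)
qed

lemma psig_tr:
  assumes "finite (worlds F)" "rel F \<subseteq> worlds F \<times> worlds F" "w \<in> worlds F"
  shows "psig (tr F w x) \<subseteq> sig x \<times> worlds F"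
proof -
  have fin: "finite {w'. (u, w') \<in> rel F}" for u
    using assms by (auto intro: finite_subset[of _ "worlds F"])
  show ?thesis using assms(3)
  proof (induction x arbitrary: w)
    case (Dia x)
    then show ?case using assms(2) by (simp add: psig_big_por fin) blast
  qed auto
qed

section \<open>Labelling the worlds of a model by members of an EME\<close>

text \<open>The restriction to \<open>worlds F\<close> places the labelling in the extensional
  function space required by \<open>abs_models\<close>.\<close>

definition label :: "'p pl set \<Rightarrow> 'w frame \<Rightarrow> ('p \<Rightarrow> 'w set) \<Rightarrow> 'w \<Rightarrow> 'p pl" where
  "label \<Phi> F V = (\<lambda>w\<in>worlds F. THE x. x \<in> \<Phi> \<and> truth F V w (emb x))"

text \<open>Existence comes from the tautological disjunction and uniqueness from pairwise
  inconsistency, both applied to the propositional valuation induced by the world.\<close>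

lemma eme_ex1:
  assumes "eme \<sigma> \<Phi>"
  shows "\<exists>!x. x \<in> \<Phi> \<and> truth F V w (emb x)"
proof -
  have "pval v (big_por \<Phi> (\<lambda>x. x))" for v
    using assms by (simp add: eme_def tautology_def)
  moreover have "finite \<Phi>" using assms by (simp add: eme_def)
  ultimately have ex: "\<exists>x\<in>\<Phi>. pval v x" for v by (simp add: pval_big_por)
  have uniq: "x = y" if "x \<in> \<Phi>" "y \<in> \<Phi>" "pval v x" "pval v y" for x y v
    using assms that unfolding eme_def tautology_def pval.simps by blast
  show ?thesis using ex uniq unfolding truth_psubst by blast
qed

lemma label_eq_iff:
  assumes "eme \<sigma> \<Phi>" "w \<in> worlds F" "x \<in> \<Phi>"
  shows "label \<Phi> F V w = x \<longleftrightarrow> truth F V w (emb x)"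
proof -
  note ex1 = eme_ex1[OF assms(1), of F V w]
  have label: "label \<Phi> F V w = (THE x. x \<in> \<Phi> \<and> truth F V w (emb x))"
    using assms(2) by (simp add: label_def)
  show ?thesis
  proof
    show "truth F V w (emb x)" if "label \<Phi> F V w = x"
      using theI'[OF ex1] that unfolding label by simp
    show "label \<Phi> F V w = x" if "truth F V w (emb x)"
      unfolding label using assms(3) that by (intro the1_equality[OF ex1] conjI)
  qed
qed

lemma label_in_PiE:
  assumes "eme \<sigma> \<Phi>"
  shows "label \<Phi> F V \<in> worlds F \<rightarrow>\<^sub>E \<Phi>"
  unfolding label_def restrict_PiE_iff
proof
  show "(THE x. x \<in> \<Phi> \<and> truth F V w (emb x)) \<in> \<Phi>" for w
    using theI'[OF eme_ex1[OF assms]] by (rule conjunct1)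
qed

text \<open>In the labelled model an atom \<open>x\<close> of \<open>\<delta>\<close> holds at
  exactly the worlds where \<open>emb x\<close> holds under \<open>V\<close>, so
  \<open>\<delta>\<close> and \<open>flat \<delta>\<close> agree at the root.\<close>

lemma label_in_abs_class:
  assumes "eme \<sigma> \<Phi>" "F \<in> \<F>" "finite_rooted_frame F" "sig \<delta> \<subseteq> \<Phi>" "truth F V 0 (flat \<delta>)"
  shows "(F, label \<Phi> F V) \<in> abs_class \<F> \<Phi> \<delta>"
proof -
  have F: "0 \<in> worlds F" "rel F \<subseteq> worlds F \<times> worlds F"
    using assms(3) by (auto simp: finite_rooted_frame_def)
  have "abs_truth F (label \<Phi> F V) 0 \<delta> \<longleftrightarrow> truth F V 0 (flat \<delta>)"
    unfolding abs_truth_def truth_msubst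
  \<comment> \<open>Labels are meaningful only on \<open>worlds F\<close>, hence the identity
    restricted to that set.\<close>
  proof (rule truth_bisimulation[where Z = "Id_on (worlds F)"])
    fix u v p assume uv: "(u, v) \<in> Id_on (worlds F)"
    then have "u = v" "u \<in> worlds F" by auto
    with label_eq_iff[OF assms(1), of u F p V] assms(4)
    show "u \<in> {u. label \<Phi> F V u = p} \<longleftrightarrow> v \<in> {u. truth F V u (emb p)}" if "p \<in> sig \<delta>"
      using that by (simp add: subset_iff)
  qed (use F in auto)
  then show ?thesis
    using assms(2,5) label_in_PiE[OF assms(1)] by (simp add: abs_class_def abs_models_def)
qed

section \<open>Bisimilarity classes of abstract models\<close>

lemma abs_bisimulation_converse:
  assumes "abs_bisimulation G f H g Z"
  shows "abs_bisimulation H g G f (Z\<inverse>)"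
  unfolding abs_bisimulation_def
proof (intro conjI)
  show "Z\<inverse> \<subseteq> worlds H \<times> worlds G"
    using assms unfolding abs_bisimulation_def by blast
  show "\<forall>(u, v)\<in>Z\<inverse>. g u = f v \<and>
      (\<forall>u'. (u, u') \<in> rel H \<longrightarrow> (\<exists>v'. (v, v') \<in> rel G \<and> (u', v') \<in> Z\<inverse>)) \<and>
      (\<forall>v'. (v, v') \<in> rel G \<longrightarrow> (\<exists>u'. (u, u') \<in> rel H \<and> (u', v') \<in> Z\<inverse>))"
  proof clarify
    fix u v assume "(v, u) \<in> Z"
    then have "f v = g u" "\<And>v'. (v, v') \<in> rel G \<Longrightarrow> \<exists>u'. (u, u') \<in> rel H \<and> (v', u') \<in> Z"
      "\<And>u'. (u, u') \<in> rel H \<Longrightarrow> \<exists>v'. (v, v') \<in> rel G \<and> (v', u') \<in> Z"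
      using assms unfolding abs_bisimulation_def by auto
    then show "g u = f v \<and>
      (\<forall>u'. (u, u') \<in> rel H \<longrightarrow> (\<exists>v'. (v, v') \<in> rel G \<and> (u', v') \<in> Z\<inverse>)) \<and>
      (\<forall>v'. (v, v') \<in> rel G \<longrightarrow> (\<exists>u'. (u, u') \<in> rel H \<and> (u', v') \<in> Z\<inverse>))"
      unfolding converse_iff by simp
  qed
qed

lemma abs_bisimulation_comp:
  assumes "abs_bisimulation G f H g Y" "abs_bisimulation H g K h Z"
  shows "abs_bisimulation G f K h (Y O Z)"
  unfolding abs_bisimulation_def
proof (intro conjI)
  show "Y O Z \<subseteq> worlds G \<times> worlds K"
    using assms unfolding abs_bisimulation_def by blast
  show "\<forall>(u, v)\<in>Y O Z. f u = h v \<and>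
      (\<forall>u'. (u, u') \<in> rel G \<longrightarrow> (\<exists>v'. (v, v') \<in> rel K \<and> (u', v') \<in> Y O Z)) \<and>
      (\<forall>v'. (v, v') \<in> rel K \<longrightarrow> (\<exists>u'. (u, u') \<in> rel G \<and> (u', v') \<in> Y O Z))"
  proof clarify
    fix u t v assume uv: "(u, t) \<in> Y" "(t, v) \<in> Z"
    have Y: "f u = g t" "\<And>u'. (u, u') \<in> rel G \<Longrightarrow> \<exists>t'. (t, t') \<in> rel H \<and> (u', t') \<in> Y"
      "\<And>t'. (t, t') \<in> rel H \<Longrightarrow> \<exists>u'. (u, u') \<in> rel G \<and> (u', t') \<in> Y"
      using assms(1) uv(1) unfolding abs_bisimulation_def by auto
    have Z: "g t = h v" "\<And>t'. (t, t') \<in> rel H \<Longrightarrow> \<exists>v'. (v, v') \<in> rel K \<and> (t', v') \<in> Z"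
      "\<And>v'. (v, v') \<in> rel K \<Longrightarrow> \<exists>t'. (t, t') \<in> rel H \<and> (t', v') \<in> Z"
      using assms(2) uv(2) unfolding abs_bisimulation_def by auto
    show "f u = h v \<and>
      (\<forall>u'. (u, u') \<in> rel G \<longrightarrow> (\<exists>v'. (v, v') \<in> rel K \<and> (u', v') \<in> Y O Z)) \<and>
      (\<forall>v'. (v, v') \<in> rel K \<longrightarrow> (\<exists>u'. (u, u') \<in> rel G \<and> (u', v') \<in> Y O Z))"
      using Y Z by (metis relcomp.relcompI)
  qed
qed

text \<open>Membership in a quotient class only relates both models to some representative
  \<open>(K, h)\<close>; going back along one bisimulation and forward along the other joins them
  directly.\<close>

lemma abs_class_bisimulation:
  assumes "abs_class_identifier \<F> \<Phi> \<delta>"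
    and "(F, f) \<in> abs_class \<F> \<Phi> \<delta>" "(G, g) \<in> abs_class \<F> \<Phi> \<delta>"
  obtains Z where "abs_bisimulation F f G g Z" "(0, 0) \<in> Z"
proof -
  obtain K h where "abs_class \<F> \<Phi> \<delta> = abs_bisimilar \<F> \<Phi> `` {(K, h)}"
    using assms(1) unfolding abs_class_identifier_def by (auto elim!: quotientE)
  with assms(2,3) obtain Y Z where
    "abs_bisimulation K h F f Y" "(0, 0) \<in> Y" "abs_bisimulation K h G g Z" "(0, 0) \<in> Z"
    by (auto simp: abs_bisimilar_def)
  then show thesis
    using abs_bisimulation_comp[OF abs_bisimulation_converse] that by blast
qed

section \<open>Truth and signature of \<open>rt\<close>\<close>

text \<open>Extensional labellings of a finite frame by a finite set are finite in number, so the
  disjunction in \<open>rt\<close> has a finite index set.\<close>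

lemma finite_abs_class_section:
  assumes "finite \<Phi>" "finite (worlds F)"
  shows "finite {f. (F, f) \<in> abs_class \<F> \<Phi> \<delta>}"
proof (rule finite_subset)
  show "{f. (F, f) \<in> abs_class \<F> \<Phi> \<delta>} \<subseteq> worlds F \<rightarrow>\<^sub>E \<Phi>"
    by (auto simp: abs_class_def abs_models_def)
  show "finite (worlds F \<rightarrow>\<^sub>E \<Phi>)" using assms by (intro finite_PiE) auto
qed

lemma truth_rt:
  assumes "encoding \<F> \<sigma> \<Gamma> \<Delta>" "finite (worlds F)"
  shows "truth G V w (rt \<F> \<sigma> \<Gamma> \<Delta> F \<xi>) \<longleftrightarrow>
    (\<forall>\<Phi>\<in>\<Gamma>. \<forall>\<delta>\<in>\<Delta> \<Phi>. truth G V w (cover \<F> \<sigma> \<Phi>) \<and> truth G V w (flat \<delta>) \<longrightarrow>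
       (\<exists>f. (F, f) \<in> abs_class \<F> \<Phi> \<delta> \<and> truth G V w (unfold_at \<F> \<xi> f)))"
proof -
  have "finite \<Gamma>" and "\<And>\<Phi>. \<Phi> \<in> \<Gamma> \<Longrightarrow> finite (\<Delta> \<Phi>) \<and> finite \<Phi>"
    using assms(1) by (auto simp: encoding_def eme_def)
  then show ?thesis
    using assms(2) by (auto simp: rt_def truth_big_and truth_big_or finite_abs_class_section)
qed

lemma sig_cover:
  assumes "eme \<sigma> \<Phi>" "finite \<sigma>"
  shows "sig (cover \<F> \<sigma> \<Phi>) \<subseteq> \<sigma>"
  using assms by (auto simp: cover_def eme_def sig_big_and sig_box_le sig_psubst)

text \<open>The indices \<open>w\<close> occurring in \<open>\<xi>\<close> lie in
  \<open>worlds F\<close>, where \<open>f w\<close> is a member of \<open>\<Phi>\<close> and hence a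
  formula over \<open>\<sigma>\<close>.\<close>

lemma sig_unfold_at:
  assumes "eme \<sigma> \<Phi>" "f \<in> worlds F \<rightarrow>\<^sub>E \<Phi>" "psig \<xi> \<subseteq> \<sigma> \<times> worlds F"
  shows "sig (unfold_at \<F> \<xi> f) \<subseteq> \<sigma>"
proof -
  have "psig (f w) \<subseteq> \<sigma>" if "w \<in> worlds F" for w
    using assms(1) PiE_mem[OF assms(2) that] by (auto simp: eme_def)
  with assms(3) show ?thesis
    by (fastforce simp: unfold_at_def sig_psubst sig_box_le)
qed

lemma sig_rt:
  assumes "encoding \<F> \<sigma> \<Gamma> \<Delta>" "finite \<sigma>" "finite (worlds F)" "psig \<xi> \<subseteq> \<sigma> \<times> worlds F"
  shows "sig (rt \<F> \<sigma> \<Gamma> \<Delta> F \<xi>) \<subseteq> \<sigma>"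
proof -
  have "finite \<Gamma>" using assms(1) by (simp add: encoding_def)
  have "sig (big_and (\<Delta> \<Phi>) (\<lambda>\<delta>. Imp (Conj (cover \<F> \<sigma> \<Phi>) (flat \<delta>))
      (big_or {f. (F, f) \<in> abs_class \<F> \<Phi> \<delta>} (\<lambda>f. unfold_at \<F> \<xi> f)))) \<subseteq> \<sigma>"
    if "\<Phi> \<in> \<Gamma>" for \<Phi>
  proof -
    have eme: "eme \<sigma> \<Phi>" and fin: "finite \<Phi>" "finite (\<Delta> \<Phi>)"
      and id: "\<And>\<delta>. \<delta> \<in> \<Delta> \<Phi> \<Longrightarrow> sig \<delta> \<subseteq> \<Phi>"
      using assms(1) that by (auto simp: encoding_def eme_def abs_class_identifier_def)
    have flat: "sig (flat \<delta>) \<subseteq> \<sigma>" if "\<delta> \<in> \<Delta> \<Phi>" for \<delta>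
      using id[OF that] eme by (fastforce simp: sig_msubst sig_psubst eme_def)
    have unfold: "sig (unfold_at \<F> \<xi> f) \<subseteq> \<sigma>" if "(F, f) \<in> abs_class \<F> \<Phi> \<delta>" for f \<delta>
      using that sig_unfold_at[OF eme _ assms(4)] by (auto simp: abs_class_def abs_models_def)
    have "sig (big_or {f. (F, f) \<in> abs_class \<F> \<Phi> \<delta>} (\<lambda>f. unfold_at \<F> \<xi> f)) \<subseteq> \<sigma>" for \<delta>
      unfolding sig_big_or[OF finite_abs_class_section[OF fin(1) assms(3)]] using unfold by blast
    then show ?thesis
      using flat sig_cover[OF eme assms(2), of \<F>] unfolding sig_big_and[OF fin(2)] by auto
  qed
  then show ?thesis
    unfolding rt_def sig_big_and[OF \<open>finite \<Gamma>\<close>] by (rule UN_least)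
qed

section \<open>The strongest implicate\<close>

text \<open>Under a cover, asking for some world with the label of \<open>u\<close> in
  \<open>V p\<close> is as good as asking \<open>u\<close> itself. This makes the variables replaced
  by \<open>unfold_at\<close> recover the valuation on \<open>\<sigma>\<close>.\<close>

lemma is_coverD:
  assumes "is_cover \<sigma> \<Phi> G V" "x \<in> \<Phi>" "u \<in> worlds G" "truth G V u (emb x)" "p \<in> \<sigma>"
  shows "(\<exists>u'\<in>worlds G. truth G V u' (emb x) \<and> u' \<in> V p) \<longleftrightarrow> u \<in> V p"
  using assms unfolding is_cover_def by blast

theorem theorem4p9:
  fixes \<F> :: "'w::zero frame set"
    and L :: "'p fm set"
    and \<phi> :: "'p fm"
    and \<sigma> :: "'p set"
    and \<Gamma> :: "'p pl set set"
    and \<Delta> :: "'p pl set \<Rightarrow> 'p pl fm set"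
    and \<xi> :: "'w frame \<Rightarrow> ('p \<times> 'w) pl"
  assumes "finite \<F>"
    and "\<And>F. F \<in> \<F> \<Longrightarrow> finite_rooted_frame F"
    and "L = Log \<F>"
    and "\<sigma> \<subseteq> sig \<phi>"
    and "encoding \<F> \<sigma> \<Gamma> \<Delta>"
    and "\<And>F. F \<in> \<F> \<Longrightarrow> uniform_interpolant (\<sigma> \<times> worlds F) (tr F 0 \<phi>) (\<xi> F)"
  shows "strongest_implicate L \<sigma> \<phi> (big_or \<F> (\<lambda>F. rt \<F> \<sigma> \<Gamma> \<Delta> F (\<xi> F)))"
proof -
  have fin: "finite (worlds F)" "rel F \<subseteq> worlds F \<times> worlds F" "0 \<in> worlds F" if "F \<in> \<F>" for F
    using assms(2)[OF that] by (auto simp: finite_rooted_frame_def)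
  have "finite \<sigma>" using assms(4) finite_sig by (rule finite_subset)
  have enc: "eme \<sigma> \<Phi>" "finite \<Phi>" "\<And>\<delta>. \<delta> \<in> \<Delta> \<Phi> \<Longrightarrow> abs_class_identifier \<F> \<Phi> \<delta>"
    "\<And>\<delta>. \<delta> \<in> \<Delta> \<Phi> \<Longrightarrow> sig \<delta> \<subseteq> \<Phi>" if "\<Phi> \<in> \<Gamma>" for \<Phi>
    using assms(5) that by (auto simp: encoding_def eme_def abs_class_identifier_def)
  have psig_\<xi>: "psig (\<xi> F) \<subseteq> \<sigma> \<times> worlds F" if "F \<in> \<F>" for F
    using assms(6)[OF that] by (simp add: uniform_interpolant_def)
  note iff_cover = truth_cover[OF assms(1) _ assms(2) enc(2) \<open>finite \<sigma>\<close>]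
  let ?\<chi> = "big_or \<F> (\<lambda>F. rt \<F> \<sigma> \<Gamma> \<Delta> F (\<xi> F))"
  have "sig ?\<chi> \<subseteq> \<sigma>"
    unfolding sig_big_or[OF assms(1)]
    using sig_rt[OF assms(5) \<open>finite \<sigma>\<close> fin(1) psig_\<xi>] by blast
  moreover have "truth F V 0 ?\<chi>" if F: "F \<in> \<F>" and "truth F V 0 \<phi>" for F V
  proof -
    \<comment> \<open>The modal valuation \<open>V\<close> is read as a valuation of the indexed
      variables, to which the interpolant applies.\<close>
    have "pval (\<lambda>(p, w). w \<in> V p) (tr F 0 \<phi>)"
      using \<open>truth F V 0 \<phi>\<close> by (simp add: pval_tr fin[OF F])
    then have \<xi>: "pval (\<lambda>(p, w). w \<in> V p) (\<xi> F)"
      using assms(6)[OF F] by (auto simp: uniform_interpolant_def tautology_def)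
    have "\<exists>f. (F, f) \<in> abs_class \<F> \<Phi> \<delta> \<and> truth F V 0 (unfold_at \<F> (\<xi> F) f)"
      if \<Phi>: "\<Phi> \<in> \<Gamma>" and \<delta>: "\<delta> \<in> \<Delta> \<Phi>" and "truth F V 0 (cover \<F> \<sigma> \<Phi>)" "truth F V 0 (flat \<delta>)"
      for \<Phi> \<delta>
    proof (intro exI conjI)
      let ?f = "label \<Phi> F V"
      show "(F, ?f) \<in> abs_class \<F> \<Phi> \<delta>"
        using label_in_abs_class[OF enc(1)[OF \<Phi>] F assms(2)[OF F] enc(4)[OF \<Phi> \<delta>]] that(4) .
      have cov: "is_cover \<sigma> \<Phi> F V" using that(3) iff_cover[OF F F \<Phi>] by simp
      have "(\<exists>u\<in>worlds F. truth F V u (emb (?f w)) \<and> u \<in> V p) \<longleftrightarrow> w \<in> V p"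
        if "p \<in> \<sigma>" "w \<in> worlds F" for p w
      proof -
        have "?f w \<in> \<Phi>" using PiE_mem[OF label_in_PiE[OF enc(1)[OF \<Phi>]] that(2)] .
        then show ?thesis
          using is_coverD[OF cov _ that(2) _ that(1)] label_eq_iff[OF enc(1)[OF \<Phi>] that(2)] by blast
      qed
      then have "truth F V 0 (unfold_at \<F> (\<xi> F) ?f) \<longleftrightarrow> pval (\<lambda>(p, w). w \<in> V p) (\<xi> F)"
        unfolding truth_unfold_at[OF assms(1) F assms(2)[OF F]]
        using psig_\<xi>[OF F] by (intro pval_cong) auto
      with \<xi> show "truth F V 0 (unfold_at \<F> (\<xi> F) ?f)" by simp
    qed
    then have "truth F V 0 (rt \<F> \<sigma> \<Gamma> \<Delta> F (\<xi> F))"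
      by (simp add: truth_rt[OF assms(5) fin(1)[OF F]])
    with F show ?thesis by (auto simp: truth_big_or assms(1))
  qed
  moreover have "truth G V 0 \<psi>"
    if \<psi>: "sig \<psi> \<subseteq> \<sigma>" "Imp \<phi> \<psi> \<in> L" and G: "G \<in> \<F>" and "truth G V 0 ?\<chi>" for \<psi> G V
  proof -
    \<comment> \<open>The true disjunct may belong to a frame \<open>F\<close> different from the
      frame \<open>G\<close> of the model.\<close>
    obtain F where F: "F \<in> \<F>" and rt: "truth G V 0 (rt \<F> \<sigma> \<Gamma> \<Delta> F (\<xi> F))"
      using \<open>truth G V 0 ?\<chi>\<close> by (auto simp: truth_big_or assms(1))
    \<comment> \<open>The encoding is applied to \<open>G\<close> and \<open>V\<close>: it selects a
      conjunct of \<open>rt\<close> whose antecedent holds in this model.\<close>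
    obtain \<Phi> \<delta> where \<Phi>: "\<Phi> \<in> \<Gamma>" and cov: "is_cover \<sigma> \<Phi> G V"
      and \<delta>: "\<delta> \<in> \<Delta> \<Phi>" "truth G V 0 (flat \<delta>)"
      using assms(5) G unfolding encoding_def by meson
    have "truth G V 0 (cover \<F> \<sigma> \<Phi>)" using cov iff_cover[OF G G \<Phi>] by simp
    then obtain f where f: "(F, f) \<in> abs_class \<F> \<Phi> \<delta>" "truth G V 0 (unfold_at \<F> (\<xi> F) f)"
      using rt \<Phi> \<delta> by (auto simp: truth_rt[OF assms(5) fin(1)[OF F]])
    have "(G, label \<Phi> G V) \<in> abs_class \<F> \<Phi> \<delta>"
      using label_in_abs_class[OF enc(1)[OF \<Phi>] G assms(2)[OF G] enc(4)[OF \<Phi> \<delta>(1)]] \<delta>(2) .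
    then obtain Z where bis: "abs_bisimulation F f G (label \<Phi> G V) Z" and Z: "(0, 0) \<in> Z"
      using abs_class_bisimulation[OF enc(3)[OF \<Phi> \<delta>(1)] f(1)] by blast
    \<comment> \<open>The valuation on \<open>F\<close> that \<open>unfold_at\<close> reads off from
      \<open>G\<close>; by \<open>truth_unfold_at\<close> it satisfies
      \<open>\<xi> F\<close>.\<close>
    define V' where "V' p = {w. \<exists>u\<in>worlds G. truth G V u (emb (f w)) \<and> u \<in> V p}" for p
    \<comment> \<open>As \<open>F\<close> is itself a frame of the logic, the implication is valid
      at its root under every valuation.\<close>
    have "tautology (PImp (tr F 0 \<phi>) (tr F 0 \<psi>))"
      using \<psi>(2) F by (auto simp: assms(3) Log_def tautology_def pval_tr fin[OF F])
    moreover have "psig (tr F 0 \<psi>) \<inter> psig (tr F 0 \<phi>) \<subseteq> \<sigma> \<times> worlds F"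
      using psig_tr[OF fin[OF F], of \<psi>] \<psi>(1) by blast
    ultimately have "tautology (PImp (\<xi> F) (tr F 0 \<psi>))"
      using assms(6)[OF F] by (simp add: uniform_interpolant_def)
    moreover have "pval (\<lambda>(p, w). w \<in> V' p) (\<xi> F)"
      using f(2) unfolding truth_unfold_at[OF assms(1) G assms(2)[OF G]] V'_def by simp
    ultimately have "pval (\<lambda>(p, w). w \<in> V' p) (tr F 0 \<psi>)"
      by (simp add: tautology_def)
    then have "truth F V' 0 \<psi>" by (simp add: pval_tr fin[OF F])
    moreover have "truth F V' 0 \<psi> \<longleftrightarrow> truth G V 0 \<psi>"
    proof (rule truth_bisimulation[OF Z])
      fix w u assume wu: "(w, u) \<in> Z"
      show "\<exists>u'. (u, u') \<in> rel G \<and> (w', u') \<in> Z" if "(w, w') \<in> rel F" for w'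
        using bis wu that unfolding abs_bisimulation_def by blast
      show "\<exists>w'. (w, w') \<in> rel F \<and> (w', u') \<in> Z" if "(u, u') \<in> rel G" for u'
        using bis wu that unfolding abs_bisimulation_def by blast
      have *: "w \<in> worlds F" "u \<in> worlds G" "label \<Phi> G V u = f w"
        using bis wu unfolding abs_bisimulation_def by auto
      have "f w \<in> \<Phi>" using f(1) *(1) by (auto simp: abs_class_def abs_models_def)
      \<comment> \<open>Related worlds share their label, so \<open>u\<close> is itself a world of
        the kind that the definition of \<open>V'\<close> at \<open>w\<close> asks for; the cover
        makes all such worlds agree on \<open>\<sigma>\<close>.\<close>
      have "truth G V u (emb (f w))"
        using label_eq_iff[OF enc(1)[OF \<Phi>] *(2) \<open>f w \<in> \<Phi>\<close>] *(3) by simp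
      then show "w \<in> V' p \<longleftrightarrow> u \<in> V p" if "p \<in> sig \<psi>" for p
        using is_coverD[OF cov \<open>f w \<in> \<Phi>\<close> *(2)] that \<psi>(1) by (auto simp: V'_def)
    qed
    ultimately show ?thesis by simp
  qed
  ultimately show ?thesis
    unfolding strongest_implicate_def assms(3) Log_def mem_Collect_eq truth.simps by blast
qed

end
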